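(* The relative precision function $\operatorname{err}_{\mathrm{rp}}(\tilde x,x)=|\ln(\tilde x/x)|$ satisfies the axioms of a metric on the set $\mathbb{R}^{>0}$ of positive real numbers, whereas the relative error function $\operatorname{err}_{\mathrm{rel}}(x,y)=\left|\frac{x-y}{x}\right|$ does not satisfy the axioms of a metric on $\mathbb{R}^{>0}$.
   Context: A metric on a set $X$ is a function $d:X\times X\to[0,\infty)$ such that $d(x,y)=0$ if and only if $x=y$, $d(x,y)=d(y,x)$, and $d(x,z)\le d(x,y)+d(y,z)$ for all $x,y,z\in X$. *)

theory Defs
  imports "HOL-Analysis.Analysis"
begin

(* The library locale Metric_space asks for nonnegativity and symmetry of d on the whole type,
   not only on the carrier. Here every axiom is relativised to X, so that values of d outside
   X are irrelevant; metric_on_iff_Metric_space relates the two notions. *)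
definition metric_on :: "'a set \<Rightarrow> ('a \<Rightarrow> 'a \<Rightarrow> real) \<Rightarrow> bool" where
  "metric_on X d \<longleftrightarrow>
     (\<forall>x\<in>X. \<forall>y\<in>X. 0 \<le> d x y) \<and>
     (\<forall>x\<in>X. \<forall>y\<in>X. d x y = 0 \<longleftrightarrow> x = y) \<and>
     (\<forall>x\<in>X. \<forall>y\<in>X. d x y = d y x) \<and>
     (\<forall>x\<in>X. \<forall>y\<in>X. \<forall>z\<in>X. d x z \<le> d x y + d y z)"

lemma metric_on_iff_Metric_space:
  "metric_on X d \<longleftrightarrow> Metric_space X (\<lambda>x y. if x \<in> X \<and> y \<in> X then d x y else 0)"
  unfolding metric_on_def Metric_space_def by auto

definition err_rp :: "real \<Rightarrow> real \<Rightarrow> real" where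
  "err_rp x' x = \<bar>ln (x' / x)\<bar>"

definition err_rel :: "real \<Rightarrow> real \<Rightarrow> real" where
  "err_rel x y = \<bar>(x - y) / x\<bar>"

end

theory Submission
  imports Defs
begin

text \<open>
  Since \<open>ln (x / y) = ln x - ln y\<close> for positive arguments, the relative precision is the usual
  distance on the real line pulled back along \<open>ln\<close>; it is a metric because \<open>ln\<close> is injective on the
  positive reals. The relative error is normalised by its first argument only, so it is not
  symmetric: the pair \<open>1, 2\<close> has relative error \<open>1\<close> in one order and \<open>1/2\<close> in the other.
\<close>

lemma metric_on_dist_pullback:
  fixes f :: "'a \<Rightarrow> 'b::metric_space"
  assumes "inj_on f X"
  shows "metric_on X (\<lambda>x y. dist (f x) (f y))"
  unfolding metric_on_def
  using assms by (auto simp: inj_on_eq_iff dist_commute dist_triangle)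

lemma metric_on_cong:
  assumes "\<And>x y. x \<in> X \<Longrightarrow> y \<in> X \<Longrightarrow> d x y = d' x y"
  shows "metric_on X d \<longleftrightarrow> metric_on X d'"
  unfolding metric_on_def using assms by simp

lemma err_rp_eq_dist_ln:
  assumes "x > 0" "y > 0"
  shows "err_rp x y = dist (ln x) (ln y)"
  using assms by (simp add: err_rp_def dist_real_def ln_div)

theorem mainTheorem1:
  shows "metric_on {0<..} err_rp \<and> \<not> metric_on {0<..} err_rel"
proof
  have "inj_on ln {0::real<..}"
    by (simp add: inj_on_def)
  then have "metric_on {0<..} (\<lambda>x y::real. dist (ln x) (ln y))"
    by (rule metric_on_dist_pullback)
  then show "metric_on {0<..} err_rp"
    by (subst metric_on_cong[where d' = "\<lambda>x y. dist (ln x) (ln y)"])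
      (simp_all add: err_rp_eq_dist_ln)
next
  have "err_rel 1 2 \<noteq> err_rel 2 1"
    by (simp add: err_rel_def)
  moreover have "(1::real) \<in> {0<..}" "(2::real) \<in> {0<..}"
    by simp_all
  ultimately show "\<not> metric_on {0<..} err_rel"
    unfolding metric_on_def by blast
qed

end
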